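(* Let $\mathcal{A}$ be a ring and let $a,b\in\mathcal{A}$ be Drazin invertible. Then: (i) If $a\in\mathrm{comm}_{r}(b)$ and $ab\in\mathrm{comm}(a)$, then $ab$ is Drazin invertible and $(ab)^{D}=b^{D}a^{D}$. (ii) If $a\in\mathrm{comm}_{l}(b)$, then $ab$ is Drazin invertible and $(ab)^{D}=a^{D}b^{D}$. (iii) If $a\in\mathrm{comm}_{w}(b)$, then $ab$ is Drazin invertible, $(ab)^{D}=a^{D}b^{D}$ and $a^{D}\in\mathrm{comm}(b^{D})$.
   Context: Rings are associative. For an element $a$ of a ring $\mathcal{A}$, $\mathrm{comm}(a)$ is the set of all elements of $\mathcal{A}$ commuting with $a$; $\mathrm{comm}_{l}(a)=\{b\in\mathcal{A}: ab\in\mathrm{comm}(a)\text{ and }ba\in\mathrm{comm}(b)\}$; $\mathrm{comm}_{r}(a)=\{b\in\mathcal{A}: ab\in\mathrm{comm}(b)\text{ and }ba\in\mathrm{comm}(a)\}$; $\mathrm{comm}_{w}(a)=\mathrm{comm}_{l}(a)\cap\mathrm{comm}_{r}(a)$. An element $a\in\mathcal{A}$ is Drazin invertible if there exist an integer $n\geq 1$ and $c\in\mathrm{comm}(a)$ such that $c=c^{2}a$ and $a^{n+1}c=a^{n}$; such a $c$ is unique, is denoted $a^{D}$ and is called the Drazin inverse of $a$. *)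

theory Defs
  imports Main
begin

text \<open>
  Rings are not assumed to have a unit, so we work in the type class \<open>ring\<close>. The library
  operation \<open>a ^ n\<close> requires a unit; only positive powers occur below, and they make
  sense in any semigroup. The value of \<open>pos_power a 0\<close> carries no meaning.
\<close>

definition pos_power :: "'a::semigroup_mult \<Rightarrow> nat \<Rightarrow> 'a" where
  "pos_power a n = (((*) a) ^^ (n - 1)) a"

lemma pos_power_1 [simp]: "pos_power a (Suc 0) = a"
  by (simp add: pos_power_def)

lemma pos_power_Suc: "n \<ge> 1 \<Longrightarrow> pos_power a (Suc n) = a * pos_power a n"
  by (cases n) (auto simp: pos_power_def)

lemma pos_power_eq_power:
  fixes a :: "'a::monoid_mult"
  shows "n \<ge> 1 \<Longrightarrow> pos_power a n = a ^ n"
proof (induction n rule: dec_induct)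
  case base
  show ?case by (simp add: pos_power_def)
next
  case (step n)
  then show ?case by (simp add: pos_power_Suc)
qed

definition comm :: "'a::ring \<Rightarrow> 'a set" where
  "comm a = {b. a * b = b * a}"

definition comm_l :: "'a::ring \<Rightarrow> 'a set" where
  "comm_l a = {b. a * b \<in> comm a \<and> b * a \<in> comm b}"

definition comm_r :: "'a::ring \<Rightarrow> 'a set" where
  "comm_r a = {b. a * b \<in> comm b \<and> b * a \<in> comm a}"

definition comm_w :: "'a::ring \<Rightarrow> 'a set" where
  "comm_w a = comm_l a \<inter> comm_r a"

definition is_drazin_inverse :: "'a::ring \<Rightarrow> 'a \<Rightarrow> bool" where
  "is_drazin_inverse a c \<longleftrightarrow>
     c \<in> comm a \<and> c = pos_power c 2 * a \<and>
     (\<exists>n\<ge>1. pos_power a (n + 1) * c = pos_power a n)"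

definition drazin_invertible :: "'a::ring \<Rightarrow> bool" where
  "drazin_invertible a \<longleftrightarrow> (\<exists>c. is_drazin_inverse a c)"

lemma is_drazin_inverse_absorb:
  fixes a c d :: "'a::ring"
  assumes c: "is_drazin_inverse a c" and d: "is_drazin_inverse a d"
  shows "(d * a) * (c * a) = d * a" and "(c * a) * (d * a) = d * a"
proof -
  have ca: "a * c = c * a" and cc: "c * c * a = c"
    using c by (auto simp: is_drazin_inverse_def comm_def pos_power_def numeral_2_eq_2)
  have da: "a * d = d * a" and dd: "d * d * a = d"
    using d by (auto simp: is_drazin_inverse_def comm_def pos_power_def numeral_2_eq_2)
  obtain n where n: "n \<ge> 1" "pos_power a (n + 1) * c = pos_power a n"
    using c by (auto simp: is_drazin_inverse_def)
  have pow_comm: "x * pos_power a k = pos_power a k * x" if "a * x = x * a" "k \<ge> 1" for x k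
    using that(2)
  proof (induction k rule: dec_induct)
    case base
    then show ?case using that(1) by (simp add: pos_power_def)
  next
    case (step k)
    then show ?case by (metis that(1) mult.assoc pos_power_Suc)
  qed
  note comm = pow_comm[OF refl] and commc = pow_comm[OF ca]
  have dax: "d * a * (d * x) = d * x" "d * (d * (a * x)) = d * x" for x
    by (metis dd da mult.assoc)+
  have L: "d * a * x = d * a * y" if "k \<ge> 1" "pos_power a k * x = pos_power a k * y" for k x y
    using that
  proof (induction k arbitrary: x y rule: dec_induct)
    case base
    then show ?case by (simp add: mult.assoc)
  next
    case (step k)
    have "pos_power a k * (a * x) = pos_power a k * (a * y)"
      using step by (metis comm mult.assoc pos_power_Suc)
    then have "d * a * (a * x) = d * a * (a * y)" by (rule step.IH)
    then have "d * (d * (a * (a * x))) = d * (d * (a * (a * y)))" by (simp add: mult.assoc)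
    then show ?case by (simp add: dax mult.assoc)
  qed
  have R: "x * (d * a) = y * (d * a)" if "k \<ge> 1" "x * pos_power a k = y * pos_power a k" for k x y
    using that
  proof (induction k arbitrary: x y rule: dec_induct)
    case base
    then show ?case by (simp flip: da add: mult.assoc[symmetric])
  next
    case (step k)
    have "(x * a) * pos_power a k = (y * a) * pos_power a k"
      using step by (metis mult.assoc pos_power_Suc)
    then have "x * a * (d * a) = y * a * (d * a)" by (rule step.IH)
    then have "x * a * (d * a) * d = y * a * (d * a) * d" by simp
    moreover have "z * a * (d * a) * d = z * (d * a)" for z
      by (metis da dd mult.assoc)
    ultimately show ?case by simp
  qed
  have 1: "pos_power a n * (c * a) * a = pos_power a n * a" 
    using n by (metis add.commute ca comm mult.assoc plus_1_eq_Suc pos_power_Suc)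
  have "d * a * (c * a * a) = d * a * a" using L[OF n(1)] 1 by (metis mult.assoc)
  then have "d * (d * a * (c * a * a)) = d * (d * a * a)" by simp
  moreover have "d * (d * a * (c * a * a)) = d * a * (c * a)"
    by (metis ca dd da mult.assoc)
  moreover have "d * (d * a * a) = d * a" by (metis dd mult.assoc)
  ultimately show "(d * a) * (c * a) = d * a" by simp
  have 2: "a * (c * a) * pos_power a n = a * pos_power a n"
    using n by (metis add.commute ca comm commc mult.assoc plus_1_eq_Suc pos_power_Suc)
  have "a * (c * a) * (d * a) = a * (d * a)" using R[OF n(1) 2] .
  then have "a * (c * a) * (d * a) * d = a * (d * a) * d" by simp
  moreover have "a * (c * a) * (d * a) * d = (c * a) * (d * a)"
    by (metis ca dd da mult.assoc)
  moreover have "a * (d * a) * d = d * a" by (metis dd da mult.assoc)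
  ultimately show "(c * a) * (d * a) = d * a" by simp
qed

lemma is_drazin_inverse_unique:
  fixes a c d :: "'a::ring"
  assumes c: "is_drazin_inverse a c" and d: "is_drazin_inverse a d"
  shows "c = d"
proof -
  have ca: "a * c = c * a" and cc: "c * c * a = c"
    using c by (auto simp: is_drazin_inverse_def comm_def pos_power_def numeral_2_eq_2)
  have da: "a * d = d * a" and dd: "d * d * a = d"
    using d by (auto simp: is_drazin_inverse_def comm_def pos_power_def numeral_2_eq_2)
  have e: "c * a = d * a"
    using is_drazin_inverse_absorb[OF c d] is_drazin_inverse_absorb[OF d c] by simp
  then show ?thesis by (metis ca cc da dd mult.assoc)
qed

definition drazin_inverse :: "'a::ring \<Rightarrow> 'a" where
  "drazin_inverse a = (THE c. is_drazin_inverse a c)"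

lemma drazin_inverse_eq_iff:
  "drazin_invertible a \<Longrightarrow> drazin_inverse a = c \<longleftrightarrow> is_drazin_inverse a c"
  unfolding drazin_invertible_def drazin_inverse_def
  by (metis is_drazin_inverse_unique theI)

end

theory Submission
  imports Defs
begin

text \<open>
  Write \<open>c\<close> and \<open>d\<close> for the Drazin inverses of \<open>a\<close> and \<open>b\<close>, with idempotents \<open>p = c * a\<close> and
  \<open>q = d * b\<close>, and let \<open>k = a * b - b * a\<close>. Every hypothesis on \<open>a\<close> and \<open>b\<close> says that some of
  the products \<open>a * k\<close>, \<open>k * a\<close>, \<open>b * k\<close>, \<open>k * b\<close> vanish, and all three parts have \<open>a * k = 0\<close>,
  that is, \<open>a * b\<close> commutes with \<open>a\<close>. The tool that turns this into statements on \<open>c\<close> and \<open>d\<close> is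
  \<open>drazin_double_commutant\<close>: whatever commutes with \<open>a\<close> commutes with \<open>c\<close>.

  From \<open>a * k = 0\<close> alone one gets \<open>(a * b)\<^sup>n = a\<^sup>n * b\<^sup>n\<close> and \<open>a * b * c * d = p * q\<close>, and hence the
  power equation for the pair \<open>a * b\<close>, \<open>c * d\<close> (\<open>drazin_product_power_eq\<close>). It remains to see
  that \<open>c * d\<close> commutes with \<open>a * b\<close> and is reproduced by \<open>p * q\<close>.

  If \<open>a * k = k * a = 0\<close>, then \<open>c\<close> commutes with \<open>b\<close> (\<open>drazin_inverse_commutes_right\<close>), hence with
  \<open>d\<close>. This is the commutation claimed in the third part. In the first part it moves the
  invertible part of \<open>a\<close> past \<open>b\<close> and \<open>d\<close>, and it makes \<open>c * d\<close> and \<open>d * c\<close> the same element.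

  If \<open>a * k = b * k = 0\<close>, then \<open>c\<close> and \<open>d\<close> need not commute, but \<open>p\<close> is absorbed on the right of
  \<open>p * d\<close> (\<open>drazin_inverse_right_absorption\<close>). The reason is that \<open>b * p - p * b = - k * c\<close> is
  annihilated by \<open>b\<close>, so that \<open>b * p\<close> commutes with \<open>b\<close> and therefore with \<open>d\<close>.
\<close>

section \<open>Positive powers\<close>

lemma pos_power_commutes:
  assumes "a * x = x * a" and "n \<ge> 1"
  shows "pos_power a n * x = x * pos_power a n"
  using assms(2)
proof (induction n rule: dec_induct)
  case base
  then show ?case using assms(1) by simp
next
  case (step n)
  have "pos_power a (Suc n) * x = a * (pos_power a n * x)"
    using step.hyps by (simp add: pos_power_Suc mult.assoc)
  also have "\<dots> = (a * x) * pos_power a n" by (simp add: step.IH mult.assoc)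
  also have "\<dots> = x * pos_power a (Suc n)"
    using step.hyps by (simp add: assms(1) pos_power_Suc mult.assoc)
  finally show ?case .
qed

lemma pos_power_Suc2: "n \<ge> 1 \<Longrightarrow> pos_power a (Suc n) = pos_power a n * a"
  by (simp add: pos_power_Suc pos_power_commutes)

text \<open>In the induction step \<open>(a * b) * (a\<^sup>n * b\<^sup>n) = a\<^sup>n * (a * b) * b\<^sup>n\<close>, so that the new factors
  \<open>a\<close> and \<open>b\<close> land next to the powers they extend.\<close>

lemma pos_power_mult_distrib_left:
  assumes "a * (a * b) = (a * b) * a" and "n \<ge> 1"
  shows "pos_power (a * b) n = pos_power a n * pos_power b n"
  using assms(2)
proof (induction n rule: dec_induct)
  case base
  then show ?case by simp
next
  case (step n)
  have "pos_power (a * b) (Suc n) = ((a * b) * pos_power a n) * pos_power b n"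
    using step by (simp add: pos_power_Suc mult.assoc)
  also have "\<dots> = (pos_power a n * (a * b)) * pos_power b n"
    using pos_power_commutes[OF assms(1) step.hyps(1)] by simp
  also have "\<dots> = pos_power a (Suc n) * pos_power b (Suc n)"
    using step.hyps by (simp add: pos_power_Suc[of n b] pos_power_Suc2[of n a] mult.assoc)
  finally show ?case .
qed

section \<open>The Drazin inverse and its idempotent\<close>

lemma is_drazin_inverse_commutes: "is_drazin_inverse a c \<Longrightarrow> a * c = c * a"
  by (simp add: is_drazin_inverse_def comm_def)

lemma is_drazin_inverse_outer: "is_drazin_inverse a c \<Longrightarrow> c * (c * a) = c"
  by (simp add: is_drazin_inverse_def pos_power_def numeral_2_eq_2 mult.assoc)

lemma is_drazin_inverse_drazin_inverse:
  "drazin_invertible a \<Longrightarrow> is_drazin_inverse a (drazin_inverse a)"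
  using drazin_inverse_eq_iff by blast

lemma pos_power_drazin_idempotent:
  assumes "is_drazin_inverse a c" and "n \<ge> 1"
  shows "pos_power c n * pos_power a n = c * a"
  using assms(2)
proof (induction n rule: dec_induct)
  case base
  then show ?case by simp
next
  case (step n)
  have "pos_power c (Suc n) * pos_power a (Suc n) = c * (pos_power c n * pos_power a n) * a"
    using step.hyps by (simp add: pos_power_Suc[of n c] pos_power_Suc2[of n a] mult.assoc)
  also have "\<dots> = c * a" using assms(1) by (simp add: step.IH is_drazin_inverse_outer)
  finally show ?case .
qed

text \<open>The power equation of the definition persists for all larger exponents, which lets two
  Drazin invertible elements share one exponent.\<close>

lemma drazin_idempotent_absorbed_eventually:
  assumes "is_drazin_inverse a c"
  obtains m where "m \<ge> 1" and "\<And>n. n \<ge> m \<Longrightarrow> pos_power a n * (c * a) = pos_power a n"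
proof -
  obtain m where m: "m \<ge> 1" "pos_power a (Suc m) * c = pos_power a m"
    using assms by (auto simp: is_drazin_inverse_def)
  have "pos_power a n * (c * a) = pos_power a n" if "n \<ge> m" for n
    using that
  proof (induction n rule: dec_induct)
    case base
    have "pos_power a m * (c * a) = pos_power a m * (a * c)"
      using is_drazin_inverse_commutes[OF assms] by simp
    then show ?case using m by (simp add: pos_power_Suc2 mult.assoc)
  next
    case (step n)
    then show ?case using m(1) by (simp add: pos_power_Suc mult.assoc)
  qed
  with m(1) show thesis by (rule that)
qed

text \<open>
  For \<open>x\<close> commuting with \<open>a\<close> and \<open>p = c * a = c\<^sup>n * a\<^sup>n\<close>, the equation \<open>a\<^sup>n * p = a\<^sup>n\<close> gives
  \<open>p * x = c\<^sup>n * x * a\<^sup>n = p * x * p\<close>, and symmetrically \<open>x * p = p * x * p\<close>. So \<open>x\<close> commutes with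
  \<open>p\<close>, and the claim becomes one about the corner of \<open>p\<close>, in which \<open>c\<close> is a genuine inverse of
  \<open>a\<close>.
\<close>

theorem drazin_double_commutant:
  assumes ac: "is_drazin_inverse a c" and ax: "a * x = x * a"
  shows "c * x = x * c"
proof -
  obtain n where n: "n \<ge> 1" and absorb: "pos_power a n * (c * a) = pos_power a n"
    using drazin_idempotent_absorbed_eventually[OF ac] by blast
  have comm: "a * c = c * a" and outer: "c * (c * a) = c"
    using ac by (rule is_drazin_inverse_commutes, rule is_drazin_inverse_outer)
  have p: "c * a = pos_power c n * pos_power a n"
    using pos_power_drazin_idempotent[OF ac n] by simp
  have cp_an: "pos_power c n * pos_power a n = pos_power a n * pos_power c n"
    using pos_power_commutes[OF pos_power_commutes[OF comm[symmetric] n, symmetric] n] by simp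
  have xn: "pos_power a n * x = x * pos_power a n"
    by (rule pos_power_commutes[OF ax n])
  have absorb': "(c * a) * pos_power a n = pos_power a n"
    using absorb pos_power_commutes[of a "c * a" n] n by (metis comm mult.assoc)
  have "(c * a) * x = pos_power c n * (x * (pos_power a n * (c * a)))"
    by (simp add: p[symmetric] absorb) (simp add: p mult.assoc xn)
  also have "\<dots> = (c * a) * (x * (c * a))"
    by (metis p xn mult.assoc)
  finally have left: "(c * a) * x = (c * a) * (x * (c * a))" .
  have "x * (c * a) = ((c * a) * pos_power a n) * (x * pos_power c n)"
    by (metis absorb' p cp_an xn mult.assoc)
  also have "\<dots> = (c * a) * (x * (c * a))"
    by (metis p cp_an xn mult.assoc)
  finally have px: "(c * a) * x = x * (c * a)" using left by simp
  have "c * x = c * ((c * a) * x)" by (metis outer mult.assoc)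
  also have "\<dots> = c * (x * (a * c))" by (simp add: px comm)
  also have "\<dots> = ((c * a) * x) * c" by (metis ax mult.assoc)
  also have "\<dots> = x * ((c * a) * c)" by (simp only: px) (simp only: mult.assoc)
  also have "\<dots> = x * c" by (metis comm outer mult.assoc)
  finally show ?thesis .
qed

section \<open>Drazin inverses of products\<close>

lemma product_mult_drazin_inverses:
  assumes ac: "is_drazin_inverse a c" and bd: "is_drazin_inverse b d"
    and aab: "a * (a * b) = (a * b) * a"
  shows "(a * b) * (c * d) = (c * a) * (d * b)"
proof -
  have "(a * b) * (c * d) = (c * (a * b)) * d"
    by (simp add: drazin_double_commutant[OF ac aab] mult.assoc)
  also have "\<dots> = (c * a) * (b * d)" by (simp add: mult.assoc)
  finally show ?thesis using is_drazin_inverse_commutes[OF bd] by simp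
qed

text \<open>The idempotent \<open>p = c * a\<close> commutes with \<open>a * b\<close>, so it can be moved in front of
  \<open>(a * b)\<^sup>n = a\<^sup>n * b\<^sup>n\<close> and absorbed by \<open>a\<^sup>n\<close>, while \<open>b\<^sup>n\<close> absorbs \<open>d * b\<close>.\<close>

lemma drazin_product_power_eq:
  assumes ac: "is_drazin_inverse a c" and bd: "is_drazin_inverse b d"
    and aab: "a * (a * b) = (a * b) * a"
  shows "\<exists>n\<ge>1. pos_power (a * b) (n + 1) * (c * d) = pos_power (a * b) n"
proof -
  obtain m where m: "m \<ge> 1" "\<And>n. n \<ge> m \<Longrightarrow> pos_power a n * (c * a) = pos_power a n"
    using drazin_idempotent_absorbed_eventually[OF ac] by blast
  obtain l where l: "l \<ge> 1" "\<And>n. n \<ge> l \<Longrightarrow> pos_power b n * (d * b) = pos_power b n"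
    using drazin_idempotent_absorbed_eventually[OF bd] by blast
  define n where "n = max m l"
  have n: "n \<ge> 1" and absorb_a: "pos_power a n * (c * a) = pos_power a n"
    and absorb_b: "pos_power b n * (d * b) = pos_power b n"
    using m l by (auto simp: n_def)
  have "(a * b) * (c * a) = (c * a) * (a * b)"
    by (metis aab drazin_double_commutant[OF ac aab] mult.assoc)
  then have move: "pos_power (a * b) n * (c * a) = (c * a) * pos_power (a * b) n"
    using n by (rule pos_power_commutes)
  have "a * (c * a) = (c * a) * a"
    using ac by (metis is_drazin_inverse_commutes mult.assoc)
  then have absorb_a': "(c * a) * pos_power a n = pos_power a n"
    using absorb_a pos_power_commutes[of a "c * a" n] n by simp
  have "pos_power (a * b) (n + 1) * (c * d) = pos_power (a * b) n * ((a * b) * (c * d))"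
    using n by (simp add: pos_power_Suc2 mult.assoc)
  also have "\<dots> = (pos_power (a * b) n * (c * a)) * (d * b)"
    by (simp only: product_mult_drazin_inverses[OF ac bd aab]) (simp only: mult.assoc)
  also have "\<dots> = ((c * a) * pos_power a n) * (pos_power b n * (d * b))"
    unfolding move by (simp add: pos_power_mult_distrib_left[OF aab n] mult.assoc)
  also have "\<dots> = pos_power (a * b) n"
    by (simp only: absorb_a' absorb_b pos_power_mult_distrib_left[OF aab n])
  finally show ?thesis using n by blast
qed

lemma is_drazin_inverse_productI:
  assumes "is_drazin_inverse a c" and "is_drazin_inverse b d"
    and "a * (a * b) = (a * b) * a"
    and "(a * b) * (c * d) = (c * d) * (a * b)"
    and "(c * d) * ((c * a) * (d * b)) = c * d"
  shows "is_drazin_inverse (a * b) (c * d)"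
proof -
  have "(c * d) * ((c * d) * (a * b)) = c * d"
    using assms(5) product_mult_drazin_inverses[OF assms(1-3)] assms(4) by simp
  then show ?thesis
    using assms(4) drazin_product_power_eq[OF assms(1-3)]
    by (simp add: is_drazin_inverse_def comm_def pos_power_def numeral_2_eq_2 mult.assoc)
qed

text \<open>Since \<open>c = c\<^sup>2 * a\<close>, whatever \<open>a\<close> annihilates from the left is annihilated by \<open>c\<close>; here it
  is \<open>a * b - b * a\<close>.\<close>

lemma drazin_inverse_mult_swap:
  assumes ac: "is_drazin_inverse a c" and aab: "a * (a * b) = (a * b) * a"
  shows "c * (a * b) = c * (b * a)"
proof -
  have outer: "c * (c * a) = c" using ac by (rule is_drazin_inverse_outer)
  have "c * (a * b) = (c * (c * a)) * (a * b)" by (simp only: outer)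
  also have "\<dots> = c * (c * (a * (a * b)))" by (simp only: mult.assoc)
  also have "\<dots> = (c * (c * a)) * (b * a)" by (simp only: aab) (simp only: mult.assoc)
  also have "\<dots> = c * (b * a)" by (simp only: outer)
  finally show ?thesis .
qed

text \<open>Both \<open>a * b\<close> and \<open>b * a\<close> commute with \<open>a\<close>, hence with \<open>c\<close>, and they agree after
  multiplication by \<open>a\<close>, hence by \<open>c\<close>. Writing \<open>c = c\<^sup>2 * a\<close> on one side of \<open>b\<close> and
  \<open>c = a * c\<^sup>2\<close> on the other then gives the same element.\<close>

lemma drazin_inverse_commutes_right:
  assumes ac: "is_drazin_inverse a c"
    and aab: "a * (a * b) = (a * b) * a" and aba: "a * (b * a) = (b * a) * a"
  shows "c * b = b * c"
proof -
  have comm: "a * c = c * a" and outer: "c * (c * a) = c"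
    using ac by (rule is_drazin_inverse_commutes, rule is_drazin_inverse_outer)
  have cba: "c * (b * a) = (b * a) * c"
    by (rule drazin_double_commutant[OF ac aba])
  have agree: "c * (a * b) = c * (b * a)"
    by (rule drazin_inverse_mult_swap[OF ac aab])
  have "c * b = c * (c * (a * b))" by (metis outer mult.assoc)
  also have "\<dots> = (b * a) * (c * c)" by (metis agree cba mult.assoc)
  also have "\<dots> = b * c" by (metis comm outer mult.assoc)
  finally show ?thesis .
qed

text \<open>Since \<open>c\<close> commutes with \<open>b\<close>, the idempotent \<open>p = c * a\<close> commutes with \<open>b\<close> and so with
  \<open>d\<close>. Thus \<open>c * d\<close> has the factors \<open>c\<close>, absorbing \<open>p\<close>, and \<open>d\<close>, absorbing \<open>d * b\<close>. That \<open>a * b\<close>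
  commutes with \<open>b\<close> is what makes it commute with \<open>d\<close>.\<close>

lemma is_drazin_inverse_product_of_comm_r:
  assumes ac: "is_drazin_inverse a c" and bd: "is_drazin_inverse b d"
    and aab: "a * (a * b) = (a * b) * a" and aba: "a * (b * a) = (b * a) * a"
    and bab: "b * (a * b) = (a * b) * b"
  shows "is_drazin_inverse (a * b) (c * d)"
proof (rule is_drazin_inverse_productI[OF ac bd aab])
  have cb: "c * b = b * c" by (rule drazin_inverse_commutes_right[OF ac aab aba])
  have swap: "c * (a * b) = c * (b * a)" by (rule drazin_inverse_mult_swap[OF ac aab])
  have cab: "c * (a * b) = (a * b) * c" by (rule drazin_double_commutant[OF ac aab])
  have dab: "d * (a * b) = (a * b) * d" by (rule drazin_double_commutant[OF bd bab])
  show "(a * b) * (c * d) = (c * d) * (a * b)" by (metis cab dab mult.assoc)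
  have "b * (c * a) = (c * a) * b" by (metis cb cab swap mult.assoc)
  then have dp: "d * (c * a) = (c * a) * d" by (rule drazin_double_commutant[OF bd])
  have "(c * d) * ((c * a) * (d * b)) = c * ((d * (c * a)) * (d * b))" by (simp add: mult.assoc)
  also have "\<dots> = (c * (c * a)) * (d * (d * b))" by (simp only: dp) (simp only: mult.assoc)
  also have "\<dots> = c * d" using ac bd by (simp add: is_drazin_inverse_outer)
  finally show "(c * d) * ((c * a) * (d * b)) = c * d" .
qed

text \<open>
  Put \<open>q = d * b = b * d\<close>. As \<open>b * p\<close> commutes with \<open>b\<close>, it commutes with \<open>d\<close>, which reads
  \<open>q * p = b * p * d\<close>. Hence \<open>p * q = p * b * p * d = p * q * p\<close>, and
  \<open>q * p * d = d * b * p * d = d * q * p = d * p\<close>. Together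
  \<open>p * d = p * q * d = p * q * p * d = p * d * p\<close>.
\<close>

lemma drazin_inverse_right_absorption:
  assumes bd: "is_drazin_inverse b d"
    and pb: "p * b = p * (b * p)" and bpb: "b * (b * p) = (b * p) * b"
  shows "p * d = p * (d * p)"
proof -
  have comm: "b * d = d * b" and outer: "d * (d * b) = d"
    using bd by (rule is_drazin_inverse_commutes, rule is_drazin_inverse_outer)
  have qp: "d * (b * p) = (b * p) * d" by (rule drazin_double_commutant[OF bd bpb])
  have pq: "p * (d * b) = p * (d * (b * p))" by (metis pb comm qp mult.assoc)
  have qpd: "d * (b * (p * d)) = d * p" by (metis qp comm outer mult.assoc)
  have "p * d = (p * (d * b)) * d" by (metis comm outer mult.assoc)
  also have "\<dots> = p * (d * (b * (p * d)))" by (simp only: pq) (simp only: mult.assoc)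
  finally show ?thesis by (simp only: qpd)
qed

text \<open>The hypotheses say that \<open>a\<close> and \<open>b\<close> annihilate \<open>k = a * b - b * a\<close> from the left, and so
  do \<open>c = c\<^sup>2 * a\<close> and \<open>d = d\<^sup>2 * b\<close>: behind \<open>c\<close> or \<open>d\<close> the products \<open>a * b\<close> and \<open>b * a\<close> are
  interchangeable. Commutation with \<open>a * b\<close> follows, and \<open>p = c * a\<close> meets the hypotheses of
  \<open>drazin_inverse_right_absorption\<close>, which yields \<open>c * d * p = c * d\<close>.\<close>

lemma is_drazin_inverse_product_of_comm_l:
  assumes ac: "is_drazin_inverse a c" and bd: "is_drazin_inverse b d"
    and aab: "a * (a * b) = (a * b) * a" and bba: "b * (b * a) = (b * a) * b"
  shows "is_drazin_inverse (a * b) (c * d)"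
proof (rule is_drazin_inverse_productI[OF ac bd aab])
  have outer_c: "c * (c * a) = c" and outer_d: "d * (d * b) = d"
    by (fact is_drazin_inverse_outer[OF ac] is_drazin_inverse_outer[OF bd])+
  have comm_c: "a * c = c * a" using ac by (rule is_drazin_inverse_commutes)
  have cab: "c * (a * b) = (a * b) * c" by (rule drazin_double_commutant[OF ac aab])
  have dba: "d * (b * a) = (b * a) * d" by (rule drazin_double_commutant[OF bd bba])
  have swap_c: "c * (a * b) = c * (b * a)" by (rule drazin_inverse_mult_swap[OF ac aab])
  have swap_d: "d * (a * b) = d * (b * a)"
    by (rule drazin_inverse_mult_swap[OF bd bba, symmetric])
  have "(a * b) * (c * d) = (c * (b * a)) * d" by (metis cab swap_c mult.assoc)
  also have "\<dots> = (c * d) * (a * b)" by (metis dba swap_d mult.assoc)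
  finally show "(a * b) * (c * d) = (c * d) * (a * b)" .
  have pb: "(c * a) * b = (c * a) * (b * (c * a))"
    by (metis cab outer_c comm_c mult.assoc)
  have "b * ((c * a) * b) = (b * (a * b)) * c" by (metis cab mult.assoc)
  also have "\<dots> = (b * (b * a)) * c" by (simp add: bba mult.assoc)
  also have "\<dots> = b * (b * (c * a))" by (simp add: comm_c mult.assoc)
  finally have "b * (b * (c * a)) = (b * (c * a)) * b" by (simp add: mult.assoc)
  with bd pb have pd: "(c * a) * d = (c * a) * (d * (c * a))"
    by (rule drazin_inverse_right_absorption)
  have "c * d = c * ((c * a) * d)" by (metis outer_c mult.assoc)
  also have "\<dots> = c * (d * (c * a))" by (metis pd outer_c mult.assoc)
  finally have cdp: "c * (d * (c * a)) = c * d" by simp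
  have "(c * d) * ((c * a) * (d * b)) = (c * (d * (c * a))) * (d * b)" by (simp add: mult.assoc)
  also have "\<dots> = c * (d * (d * b))" by (simp only: cdp) (simp only: mult.assoc)
  finally show "(c * d) * ((c * a) * (d * b)) = c * d" by (simp only: outer_d)
qed

section \<open>Drazin inverses of products under one-sided commutation\<close>

theorem proposition2p5:
  fixes a b :: "'a::ring"
  assumes "drazin_invertible a" and "drazin_invertible b"
  shows "(a \<in> comm_r b \<and> a * b \<in> comm a \<longrightarrow>
            drazin_invertible (a * b) \<and>
            drazin_inverse (a * b) = drazin_inverse b * drazin_inverse a) \<and>
         (a \<in> comm_l b \<longrightarrow>
            drazin_invertible (a * b) \<and>
            drazin_inverse (a * b) = drazin_inverse a * drazin_inverse b) \<and>
         (a \<in> comm_w b \<longrightarrow>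
            drazin_invertible (a * b) \<and>
            drazin_inverse (a * b) = drazin_inverse a * drazin_inverse b \<and>
            drazin_inverse a \<in> comm (drazin_inverse b))"
proof -
  let ?c = "drazin_inverse a" and ?d = "drazin_inverse b"
  have ac: "is_drazin_inverse a ?c" and bd: "is_drazin_inverse b ?d"
    by (fact assms[THEN is_drazin_inverse_drazin_inverse])+
  have inverseI: "drazin_invertible (a * b) \<and> drazin_inverse (a * b) = e"
    if "is_drazin_inverse (a * b) e" for e
    using that drazin_inverse_eq_iff drazin_invertible_def by blast
  have inverses_commute: "?d * ?c = ?c * ?d"
    if "a * (a * b) = (a * b) * a" "a * (b * a) = (b * a) * a"
    using drazin_double_commutant[OF bd drazin_inverse_commutes_right[OF ac that, symmetric]] .
  have part_l: "drazin_invertible (a * b) \<and> drazin_inverse (a * b) = ?c * ?d"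
    if "a \<in> comm_l b"
    using that is_drazin_inverse_product_of_comm_l[OF ac bd]
    by (intro inverseI) (auto simp: comm_l_def comm_def)
  have part_r: "drazin_invertible (a * b) \<and> drazin_inverse (a * b) = ?d * ?c"
    if "a \<in> comm_r b" "a * b \<in> comm a"
  proof -
    have eqs: "a * (a * b) = (a * b) * a" "a * (b * a) = (b * a) * a" "b * (a * b) = (a * b) * b"
      using that by (auto simp: comm_r_def comm_def)
    show ?thesis
      using inverseI[OF is_drazin_inverse_product_of_comm_r[OF ac bd eqs]]
        inverses_commute[OF eqs(1,2)] by simp
  qed
  have part_w: "?c \<in> comm ?d" if "a \<in> comm_w b"
    using that inverses_commute by (simp add: comm_w_def comm_l_def comm_r_def comm_def)
  show ?thesis using part_l part_r part_w by (auto simp: comm_w_def)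
qed

end
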